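(* Let $\mathcal{A}_\mathsf{t} = (Q_\mathsf{t}, \delta_\mathsf{t}, i_\mathsf{t}, o_\mathsf{t})$ be an automaton in $\mathbf{C}$, let $\mathcal{W} = (\alpha\colon S \to Q_\mathsf{t},\ \beta\colon Q_\mathsf{t} \to P)$ be a closed and consistent wrapper (with respect to $\mathcal{A}_\mathsf{t}$), and let $\rho\colon S' \to F_I S'$ be a recursive coalgebra. If the wrapper $\mathcal{W}' = ([\alpha, [i_\mathsf{t}, \delta_\mathsf{t}]^\rho]\colon S + S' \to Q_\mathsf{t},\ \beta\colon Q_\mathsf{t}\to P)$ is closed and consistent, then $\mathcal{W}$ is correct up to $\rho$.
   Context: Setting. $\mathbf{C}$ is a category with finite products and coproducts and a fixed factorisation system $(\mathcal{E},\mathcal{M})$: $\mathcal{E}$ and $\mathcal{M}$ are classes of morphisms closed under composition with isomorphisms, every morphism factors as $m\circ e$ with $e\in\mathcal{E}$, $m\in\mathcal{M}$, and the unique diagonal fill-in property holds. $\mathcal{E}$ consists of epis and $\mathcal{M}$ of monos. $F\colon \mathbf{C}\to\mathbf{C}$ is an endofunctor that preserves $\mathcal{E}$ and is a varietor (free $F$-algebras exist on every object). $I$ and $O$ are fixed objects, and $F_I = I + F(-)$. Automata. An automaton $(Q,\delta,i,o)$ consists of an object $Q$ and morphisms $\delta\colon FQ\to Q$, $i\colon I\to Q$, $o\colon Q\to O$. Thus $[i,\delta]\colon F_I Q\to Q$ is an $F_I$-algebra. Recursive coalgebras. A coalgebra $\rho\colon S\to F_I S$ is recursive if for every algebra $x\colon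 F_I X\to X$ there is a unique morphism $x^\rho\colon S\to X$ with $x^\rho = x\circ F_I x^\rho\circ\rho$. The $\rho$-language of an automaton $\mathcal{A}=(Q,\delta,i,o)$ is $\mathcal{L}^\rho_\mathcal{A} = o\circ[i,\delta]^\rho\colon S\to O$. Wrappers. A wrapper for an object $Q$ is a pair $\mathcal{W}=(\alpha\colon S\to Q,\ \beta\colon Q\to P)$; write $\beta\circ\alpha = m_\mathcal{W}\circ e_\mathcal{W}$ for its $(\mathcal{E},\mathcal{M})$-factorisation, through the object $H_\mathcal{W}$. When $Q$ is the state space of an automaton $(Q,\delta,i,o)$: - $\mathcal{W}$ is closed if there are $i_\mathcal{W}\colon I\to H_\mathcal{W}$ and $\mathsf{close}_\mathcal{W}\colon FS\to H_\mathcal{W}$ with $m_\mathcal{W}\circ i_\mathcal{W}=\beta\circ i$ and $m_\mathcal{W}\circ\mathsf{close}_\mathcal{W}=\beta\circ\delta\circ F\alpha$; - $\mathcal{W}$ is consistent if there are $o_\mathcal{W}\colon H_\mathcal{W}\to O$ and $\mathsf{cons}_\mathcal{W}\colon FH_\mathcal{W}\to P$ with $o_\mathcal{W}\circ e_\mathcal{W}=o\circ\alpha$ and $\mathsf{cons}_\mathcal{W}\circ Fe_\mathcal{W}=\beta\circ\delta\circ F\alpha$. Hypothesis. A closed and consistent wrapper $\mathcal{W}$ induces the hypothesis automaton $\mathcal{H}_\mathcal{W}=(H_\mathcal{W},\delta_\mathcal{W},i_\mathcal{W},o_\mathcal{W})$, where $\delta_\mathcal{W}\colon FH_\mathcal{W}\to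 H_\mathcal{W}$ is the unique diagonal with $\delta_\mathcal{W}\circ Fe_\mathcal{W}=\mathsf{close}_\mathcal{W}$ and $m_\mathcal{W}\circ\delta_\mathcal{W}=\mathsf{cons}_\mathcal{W}$. Correctness up to $\rho$. A closed and consistent wrapper $\mathcal{W}$ for $Q_\mathsf{t}$ is correct up to a recursive $\rho\colon S\to F_I S$ if $\mathcal{L}^\rho_{\mathcal{H}_\mathcal{W}}=\mathcal{L}^\rho_{\mathcal{A}_\mathsf{t}}$. *)

theory Defs
  imports Main
begin

text \<open>
  Objects and arrows form carrier sets; nothing is specified about \<open>g \<cdot> f\<close> unless \<open>cd f = dm g\<close>.
\<close>

record ('o, 'a) category =
  Ob :: "'o set"
  Ar :: "'a set"
  dm :: "'a \<Rightarrow> 'o"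
  cd :: "'a \<Rightarrow> 'o"
  ident :: "'o \<Rightarrow> 'a"
  cmp :: "'a \<Rightarrow> 'a \<Rightarrow> 'a" (infixr "\<cdot>\<index>" 70)

definition hom :: "('o, 'a, 'm) category_scheme \<Rightarrow> 'o \<Rightarrow> 'o \<Rightarrow> 'a set" where
  "hom C A B = {f \<in> Ar C. dm C f = A \<and> cd C f = B}"

locale category =
  fixes C :: "('o, 'a, 'm) category_scheme" (structure)
  assumes dm_in_Ob: "f \<in> Ar C \<Longrightarrow> dm C f \<in> Ob C"
    and cd_in_Ob: "f \<in> Ar C \<Longrightarrow> cd C f \<in> Ob C"
    and ident_in_hom: "A \<in> Ob C \<Longrightarrow> ident C A \<in> hom C A A"
    and cmp_in_hom: "\<lbrakk>f \<in> hom C A B; g \<in> hom C B D\<rbrakk> \<Longrightarrow> g \<cdot> f \<in> hom C A D"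
    and cmp_assoc: "\<lbrakk>f \<in> hom C A B; g \<in> hom C B D; h \<in> hom C D E\<rbrakk>
                     \<Longrightarrow> (h \<cdot> g) \<cdot> f = h \<cdot> (g \<cdot> f)"
    and cmp_ident_right: "f \<in> hom C A B \<Longrightarrow> f \<cdot> ident C A = f"
    and cmp_ident_left: "f \<in> hom C A B \<Longrightarrow> ident C B \<cdot> f = f"

definition is_epi :: "('o, 'a, 'm) category_scheme \<Rightarrow> 'a \<Rightarrow> bool" where
  "is_epi C e \<longleftrightarrow> e \<in> Ar C \<and>
     (\<forall>X. \<forall>g \<in> hom C (cd C e) X. \<forall>h \<in> hom C (cd C e) X. g \<cdot>\<^bsub>C\<^esub> e = h \<cdot>\<^bsub>C\<^esub> e \<longrightarrow> g = h)"

definition is_mono :: "('o, 'a, 'm) category_scheme \<Rightarrow> 'a \<Rightarrow> bool" where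
  "is_mono C m \<longleftrightarrow> m \<in> Ar C \<and>
     (\<forall>X. \<forall>g \<in> hom C X (dm C m). \<forall>h \<in> hom C X (dm C m). m \<cdot>\<^bsub>C\<^esub> g = m \<cdot>\<^bsub>C\<^esub> h \<longrightarrow> g = h)"

definition is_iso :: "('o, 'a, 'm) category_scheme \<Rightarrow> 'a \<Rightarrow> bool" where
  "is_iso C f \<longleftrightarrow> f \<in> Ar C \<and>
     (\<exists>g \<in> hom C (cd C f) (dm C f).
        g \<cdot>\<^bsub>C\<^esub> f = ident C (dm C f) \<and> f \<cdot>\<^bsub>C\<^esub> g = ident C (cd C f))"

definition is_initial :: "('o, 'a, 'm) category_scheme \<Rightarrow> 'o \<Rightarrow> bool" where
  "is_initial C Z \<longleftrightarrow> Z \<in> Ob C \<and> (\<forall>X \<in> Ob C. \<exists>!f. f \<in> hom C Z X)"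

definition is_terminal :: "('o, 'a, 'm) category_scheme \<Rightarrow> 'o \<Rightarrow> bool" where
  "is_terminal C T \<longleftrightarrow> T \<in> Ob C \<and> (\<forall>X \<in> Ob C. \<exists>!f. f \<in> hom C X T)"

definition is_product :: "('o, 'a, 'm) category_scheme \<Rightarrow> 'o \<Rightarrow> 'o \<Rightarrow> 'o \<Rightarrow> 'a \<Rightarrow> 'a \<Rightarrow> bool" where
  "is_product C A B P p q \<longleftrightarrow> P \<in> Ob C \<and> p \<in> hom C P A \<and> q \<in> hom C P B \<and>
     (\<forall>X. \<forall>f \<in> hom C X A. \<forall>g \<in> hom C X B.
        \<exists>!h. h \<in> hom C X P \<and> p \<cdot>\<^bsub>C\<^esub> h = f \<and> q \<cdot>\<^bsub>C\<^esub> h = g)"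

definition is_coproduct :: "('o, 'a, 'm) category_scheme \<Rightarrow> 'o \<Rightarrow> 'o \<Rightarrow> 'o \<Rightarrow> 'a \<Rightarrow> 'a \<Rightarrow> bool" where
  "is_coproduct C A B S l r \<longleftrightarrow> S \<in> Ob C \<and> l \<in> hom C A S \<and> r \<in> hom C B S \<and>
     (\<forall>X. \<forall>f \<in> hom C A X. \<forall>g \<in> hom C B X.
        \<exists>!h. h \<in> hom C S X \<and> h \<cdot>\<^bsub>C\<^esub> l = f \<and> h \<cdot>\<^bsub>C\<^esub> r = g)"

text \<open>
  Binary coproducts and factorisations are given by arbitrary but fixed choices: \<open>coprod A B\<close>
  with its injections, and \<open>fac_m f \<cdot> fac_e f\<close> for an arrow \<open>f\<close>.  Since the choices are
  only required to have the defining properties, everything stated about the setting holds for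
  all choices.  \<open>EE\<close> and \<open>MM\<close> are the two classes of the factorisation system,
  \<open>Fo\<close> and \<open>Fa\<close> the object and arrow part of the endofunctor, and \<open>Iob\<close>, \<open>Oob\<close> the input
  and output objects.
\<close>

record ('o, 'a) aut_category = "('o, 'a) category" +
  coprod :: "'o \<Rightarrow> 'o \<Rightarrow> 'o"
  inl :: "'o \<Rightarrow> 'o \<Rightarrow> 'a"
  inr :: "'o \<Rightarrow> 'o \<Rightarrow> 'a"
  EE :: "'a set"
  MM :: "'a set"
  fac_e :: "'a \<Rightarrow> 'a"
  fac_m :: "'a \<Rightarrow> 'a"
  Fo :: "'o \<Rightarrow> 'o"
  Fa :: "'a \<Rightarrow> 'a"
  Iob :: "'o"
  Oob :: "'o"

text \<open>
  Finite products and coproducts are rendered by their nullary and binary cases.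
\<close>

locale finite_prod_coprod_category = category C
  for C :: "('o, 'a, 'm) aut_category_scheme" (structure) +
  assumes ex_terminal: "\<exists>T. is_terminal C T"
    and ex_product: "\<lbrakk>A \<in> Ob C; B \<in> Ob C\<rbrakk> \<Longrightarrow> \<exists>P p q. is_product C A B P p q"
    and ex_initial: "\<exists>Z. is_initial C Z"
    and coproduct: "\<lbrakk>A \<in> Ob C; B \<in> Ob C\<rbrakk>
                     \<Longrightarrow> is_coproduct C A B (coprod C A B) (inl C A B) (inr C A B)"

locale factorisation_system = category C
  for C :: "('o, 'a, 'm) aut_category_scheme" (structure) +
  assumes EE_epi: "e \<in> EE C \<Longrightarrow> is_epi C e"
    and MM_mono: "m \<in> MM C \<Longrightarrow> is_mono C m"
    and EE_iso_left: "\<lbrakk>e \<in> EE C; is_iso C j; dm C j = cd C e\<rbrakk> \<Longrightarrow> j \<cdot> e \<in> EE C"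
    and EE_iso_right: "\<lbrakk>e \<in> EE C; is_iso C j; cd C j = dm C e\<rbrakk> \<Longrightarrow> e \<cdot> j \<in> EE C"
    and MM_iso_left: "\<lbrakk>m \<in> MM C; is_iso C j; dm C j = cd C m\<rbrakk> \<Longrightarrow> j \<cdot> m \<in> MM C"
    and MM_iso_right: "\<lbrakk>m \<in> MM C; is_iso C j; cd C j = dm C m\<rbrakk> \<Longrightarrow> m \<cdot> j \<in> MM C"
    and factorisation: "f \<in> Ar C \<Longrightarrow>
          fac_e C f \<in> EE C \<and> fac_m C f \<in> MM C \<and> cd C (fac_e C f) = dm C (fac_m C f) \<and>
          fac_m C f \<cdot> fac_e C f = f"
    and diagonal: "\<lbrakk>e \<in> EE C; m \<in> MM C; f \<in> hom C (dm C e) (dm C m); g \<in> hom C (cd C e) (cd C m);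
                     m \<cdot> f = g \<cdot> e\<rbrakk>
          \<Longrightarrow> \<exists>!d. d \<in> hom C (cd C e) (dm C m) \<and> d \<cdot> e = f \<and> m \<cdot> d = g"

locale endofunctor = category C
  for C :: "('o, 'a, 'm) aut_category_scheme" (structure) +
  assumes Fo_in_Ob: "A \<in> Ob C \<Longrightarrow> Fo C A \<in> Ob C"
    and Fa_in_hom: "f \<in> hom C A B \<Longrightarrow> Fa C f \<in> hom C (Fo C A) (Fo C B)"
    and Fa_ident: "A \<in> Ob C \<Longrightarrow> Fa C (ident C A) = ident C (Fo C A)"
    and Fa_cmp: "\<lbrakk>f \<in> hom C A B; g \<in> hom C B D\<rbrakk> \<Longrightarrow> Fa C (g \<cdot> f) = Fa C g \<cdot> Fa C f"

definition free_algebra :: "('o, 'a, 'm) aut_category_scheme \<Rightarrow> 'o \<Rightarrow> 'o \<Rightarrow> 'a \<Rightarrow> 'a \<Rightarrow> bool" where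
  "free_algebra C X A a \<eta> \<longleftrightarrow> A \<in> Ob C \<and> a \<in> hom C (Fo C A) A \<and> \<eta> \<in> hom C X A \<and>
     (\<forall>B \<in> Ob C. \<forall>b \<in> hom C (Fo C B) B. \<forall>f \<in> hom C X B.
        \<exists>!h. h \<in> hom C A B \<and> h \<cdot>\<^bsub>C\<^esub> a = b \<cdot>\<^bsub>C\<^esub> Fa C h \<and> h \<cdot>\<^bsub>C\<^esub> \<eta> = f)"

definition is_varietor :: "('o, 'a, 'm) aut_category_scheme \<Rightarrow> bool" where
  "is_varietor C \<longleftrightarrow> (\<forall>X \<in> Ob C. \<exists>A a \<eta>. free_algebra C X A a \<eta>)"

locale automata_setting =
  finite_prod_coprod_category C + factorisation_system C + endofunctor C
  for C :: "('o, 'a, 'm) aut_category_scheme" (structure) +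
  assumes F_preserves_EE: "e \<in> EE C \<Longrightarrow> Fa C e \<in> EE C"
    and varietor: "is_varietor C"
    and Iob_in_Ob: "Iob C \<in> Ob C"
    and Oob_in_Ob: "Oob C \<in> Ob C"

text \<open>
  The definite descriptions here and below denote the arrows whose unique existence follows
  from the universal property of coproducts, from recursiveness, and, for closed and consistent
  wrappers, from the factorisation system; they are meaningful only under these hypotheses.
\<close>

definition copair :: "('o, 'a, 'm) aut_category_scheme \<Rightarrow> 'a \<Rightarrow> 'a \<Rightarrow> 'a" where
  "copair C f g = (THE h. h \<in> hom C (coprod C (dm C f) (dm C g)) (cd C f) \<and>
     h \<cdot>\<^bsub>C\<^esub> inl C (dm C f) (dm C g) = f \<and> h \<cdot>\<^bsub>C\<^esub> inr C (dm C f) (dm C g) = g)"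

definition coprod_ar :: "('o, 'a, 'm) aut_category_scheme \<Rightarrow> 'a \<Rightarrow> 'a \<Rightarrow> 'a" where
  "coprod_ar C f g = copair C (inl C (cd C f) (cd C g) \<cdot>\<^bsub>C\<^esub> f) (inr C (cd C f) (cd C g) \<cdot>\<^bsub>C\<^esub> g)"

definition FIo :: "('o, 'a, 'm) aut_category_scheme \<Rightarrow> 'o \<Rightarrow> 'o" where
  "FIo C X = coprod C (Iob C) (Fo C X)"

definition FIa :: "('o, 'a, 'm) aut_category_scheme \<Rightarrow> 'a \<Rightarrow> 'a" where
  "FIa C f = coprod_ar C (ident C (Iob C)) (Fa C f)"

definition recursive :: "('o, 'a, 'm) aut_category_scheme \<Rightarrow> 'o \<Rightarrow> 'a \<Rightarrow> bool" where
  "recursive C S \<rho> \<longleftrightarrow> S \<in> Ob C \<and> \<rho> \<in> hom C S (FIo C S) \<and>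
     (\<forall>X \<in> Ob C. \<forall>x \<in> hom C (FIo C X) X.
        \<exists>!h. h \<in> hom C S X \<and> h = x \<cdot>\<^bsub>C\<^esub> FIa C h \<cdot>\<^bsub>C\<^esub> \<rho>)"

text \<open>\<open>rec_ext C \<rho> x\<close> is the morphism written \<open>x\<^sup>\<rho>\<close> in informal notation.\<close>

definition rec_ext :: "('o, 'a, 'm) aut_category_scheme \<Rightarrow> 'a \<Rightarrow> 'a \<Rightarrow> 'a" where
  "rec_ext C \<rho> x = (THE h. h \<in> hom C (dm C \<rho>) (cd C x) \<and> h = x \<cdot>\<^bsub>C\<^esub> FIa C h \<cdot>\<^bsub>C\<^esub> \<rho>)"

record ('o, 'a) automaton =
  states :: "'o"
  delta :: "'a"
  init :: "'a"
  out :: "'a"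

definition is_automaton :: "('o, 'a, 'm) aut_category_scheme \<Rightarrow> ('o, 'a) automaton \<Rightarrow> bool" where
  "is_automaton C A \<longleftrightarrow> states A \<in> Ob C \<and>
     delta A \<in> hom C (Fo C (states A)) (states A) \<and>
     init A \<in> hom C (Iob C) (states A) \<and>
     out A \<in> hom C (states A) (Oob C)"

definition rlang :: "('o, 'a, 'm) aut_category_scheme \<Rightarrow> 'a \<Rightarrow> ('o, 'a) automaton \<Rightarrow> 'a" where
  "rlang C \<rho> A = out A \<cdot>\<^bsub>C\<^esub> rec_ext C \<rho> (copair C (init A) (delta A))"

record 'a wrapper =
  wr_in :: "'a"
  wr_out :: "'a"

definition is_wrapper :: "('o, 'a, 'm) aut_category_scheme \<Rightarrow> 'o \<Rightarrow> 'a wrapper \<Rightarrow> bool" where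
  "is_wrapper C Q W \<longleftrightarrow> wr_in W \<in> Ar C \<and> wr_out W \<in> Ar C \<and>
     cd C (wr_in W) = Q \<and> dm C (wr_out W) = Q"

definition wr_e :: "('o, 'a, 'm) aut_category_scheme \<Rightarrow> 'a wrapper \<Rightarrow> 'a" where
  "wr_e C W = fac_e C (wr_out W \<cdot>\<^bsub>C\<^esub> wr_in W)"

definition wr_m :: "('o, 'a, 'm) aut_category_scheme \<Rightarrow> 'a wrapper \<Rightarrow> 'a" where
  "wr_m C W = fac_m C (wr_out W \<cdot>\<^bsub>C\<^esub> wr_in W)"

definition wr_H :: "('o, 'a, 'm) aut_category_scheme \<Rightarrow> 'a wrapper \<Rightarrow> 'o" where
  "wr_H C W = dm C (wr_m C W)"

definition is_init_wit ::
  "('o, 'a, 'm) aut_category_scheme \<Rightarrow> ('o, 'a) automaton \<Rightarrow> 'a wrapper \<Rightarrow> 'a \<Rightarrow> bool" where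
  "is_init_wit C A W i \<longleftrightarrow> i \<in> hom C (Iob C) (wr_H C W) \<and>
     wr_m C W \<cdot>\<^bsub>C\<^esub> i = wr_out W \<cdot>\<^bsub>C\<^esub> init A"

definition is_close_wit ::
  "('o, 'a, 'm) aut_category_scheme \<Rightarrow> ('o, 'a) automaton \<Rightarrow> 'a wrapper \<Rightarrow> 'a \<Rightarrow> bool" where
  "is_close_wit C A W c \<longleftrightarrow> c \<in> hom C (Fo C (dm C (wr_in W))) (wr_H C W) \<and>
     wr_m C W \<cdot>\<^bsub>C\<^esub> c = wr_out W \<cdot>\<^bsub>C\<^esub> delta A \<cdot>\<^bsub>C\<^esub> Fa C (wr_in W)"

definition is_out_wit ::
  "('o, 'a, 'm) aut_category_scheme \<Rightarrow> ('o, 'a) automaton \<Rightarrow> 'a wrapper \<Rightarrow> 'a \<Rightarrow> bool" where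
  "is_out_wit C A W p \<longleftrightarrow> p \<in> hom C (wr_H C W) (Oob C) \<and>
     p \<cdot>\<^bsub>C\<^esub> wr_e C W = out A \<cdot>\<^bsub>C\<^esub> wr_in W"

definition is_cons_wit ::
  "('o, 'a, 'm) aut_category_scheme \<Rightarrow> ('o, 'a) automaton \<Rightarrow> 'a wrapper \<Rightarrow> 'a \<Rightarrow> bool" where
  "is_cons_wit C A W k \<longleftrightarrow> k \<in> hom C (Fo C (wr_H C W)) (cd C (wr_out W)) \<and>
     k \<cdot>\<^bsub>C\<^esub> Fa C (wr_e C W) = wr_out W \<cdot>\<^bsub>C\<^esub> delta A \<cdot>\<^bsub>C\<^esub> Fa C (wr_in W)"

definition closed :: "('o, 'a, 'm) aut_category_scheme \<Rightarrow> ('o, 'a) automaton \<Rightarrow> 'a wrapper \<Rightarrow> bool" where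
  "closed C A W \<longleftrightarrow> (\<exists>i. is_init_wit C A W i) \<and> (\<exists>c. is_close_wit C A W c)"

definition consistent :: "('o, 'a, 'm) aut_category_scheme \<Rightarrow> ('o, 'a) automaton \<Rightarrow> 'a wrapper \<Rightarrow> bool" where
  "consistent C A W \<longleftrightarrow> (\<exists>p. is_out_wit C A W p) \<and> (\<exists>k. is_cons_wit C A W k)"

text \<open>
  The four witnesses are unique because \<open>wr_m C W\<close> is mono and \<open>wr_e C W\<close>, \<open>Fa C (wr_e C W)\<close>
  are epi.
\<close>

definition wr_init :: "('o, 'a, 'm) aut_category_scheme \<Rightarrow> ('o, 'a) automaton \<Rightarrow> 'a wrapper \<Rightarrow> 'a" where
  "wr_init C A W = (THE i. is_init_wit C A W i)"

definition wr_close :: "('o, 'a, 'm) aut_category_scheme \<Rightarrow> ('o, 'a) automaton \<Rightarrow> 'a wrapper \<Rightarrow> 'a" where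
  "wr_close C A W = (THE c. is_close_wit C A W c)"

definition wr_outp :: "('o, 'a, 'm) aut_category_scheme \<Rightarrow> ('o, 'a) automaton \<Rightarrow> 'a wrapper \<Rightarrow> 'a" where
  "wr_outp C A W = (THE p. is_out_wit C A W p)"

definition wr_cons :: "('o, 'a, 'm) aut_category_scheme \<Rightarrow> ('o, 'a) automaton \<Rightarrow> 'a wrapper \<Rightarrow> 'a" where
  "wr_cons C A W = (THE k. is_cons_wit C A W k)"

definition wr_delta :: "('o, 'a, 'm) aut_category_scheme \<Rightarrow> ('o, 'a) automaton \<Rightarrow> 'a wrapper \<Rightarrow> 'a" where
  "wr_delta C A W = (THE d. d \<in> hom C (Fo C (wr_H C W)) (wr_H C W) \<and>
     d \<cdot>\<^bsub>C\<^esub> Fa C (wr_e C W) = wr_close C A W \<and> wr_m C W \<cdot>\<^bsub>C\<^esub> d = wr_cons C A W)"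

definition hypothesis ::
  "('o, 'a, 'm) aut_category_scheme \<Rightarrow> ('o, 'a) automaton \<Rightarrow> 'a wrapper \<Rightarrow> ('o, 'a) automaton" where
  "hypothesis C A W = \<lparr>states = wr_H C W, delta = wr_delta C A W,
                       init = wr_init C A W, out = wr_outp C A W\<rparr>"

definition correct_up_to ::
  "('o, 'a, 'm) aut_category_scheme \<Rightarrow> ('o, 'a) automaton \<Rightarrow> 'a wrapper \<Rightarrow> 'a \<Rightarrow> bool" where
  "correct_up_to C A W \<rho> \<longleftrightarrow> rlang C \<rho> (hypothesis C A W) = rlang C \<rho> A"

end

(*
  Let r = [i_t, delta_t]^rho, and let H, H' be the hypotheses of W, W'.  Since alpha factors
  through [alpha, r], the diagonal fill-in gives an arrow H -> H'; it is a homomorphism of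
  automata, so H and H' have the same rho-language.  For W', the run r factors as
  [alpha, r] . inr, and e' . inr solves the recursion defining the run of H' (test this after
  composing with the mono m').  Finally o' . e' . inr = o_t . [alpha, r] . inr = o_t . r, which
  is the language of the target.
*)

theory Submission
  imports Defs
begin

section \<open>Typing of arrows and cancellation of epis and monos\<close>

context category
begin

lemma homD:
  assumes "f \<in> hom C X Y"
  shows "f \<in> Ar C" "dm C f = X" "cd C f = Y" "X \<in> Ob C" "Y \<in> Ob C"
  using assms dm_in_Ob cd_in_Ob by (auto simp: hom_def)

lemma epi_cancel:
  assumes "is_epi C e" "e \<in> hom C X Y" "f \<in> hom C Y Z" "g \<in> hom C Y Z" "f \<cdot> e = g \<cdot> e"
  shows "f = g"
  using assms unfolding is_epi_def hom_def by auto

lemma mono_cancel: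
  assumes "is_mono C m" "m \<in> hom C Y Z" "f \<in> hom C X Y" "g \<in> hom C X Y" "m \<cdot> f = m \<cdot> g"
  shows "f = g"
  using assms unfolding is_mono_def hom_def by auto

end

section \<open>Copairing and its universal property\<close>

context finite_prod_coprod_category
begin

lemma
  assumes "X \<in> Ob C" "Y \<in> Ob C"
  shows inl_in_hom: "inl C X Y \<in> hom C X (coprod C X Y)"
    and inr_in_hom: "inr C X Y \<in> hom C Y (coprod C X Y)"
  using coproduct[OF assms] by (auto simp: is_coproduct_def)

text \<open>The definite description in \<open>copair\<close> reads its objects off the arrows, so
  for two arrows into a common object it is the mediating arrow of the chosen coproduct. From here
  on only these four facts are used, never the description.\<close>

lemma
  assumes f: "f \<in> hom C X Z" and g: "g \<in> hom C Y Z"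
  shows copair_in_hom: "copair C f g \<in> hom C (coprod C X Y) Z"
    and copair_inl: "copair C f g \<cdot> inl C X Y = f"
    and copair_inr: "copair C f g \<cdot> inr C X Y = g"
    and copair_eqI: "\<lbrakk>h \<in> hom C (coprod C X Y) Z; h \<cdot> inl C X Y = f; h \<cdot> inr C X Y = g\<rbrakk>
                       \<Longrightarrow> copair C f g = h"
proof -
  have ex1: "\<exists>!h. h \<in> hom C (coprod C X Y) Z \<and> h \<cdot> inl C X Y = f \<and> h \<cdot> inr C X Y = g"
    using coproduct[OF homD(4)[OF f] homD(4)[OF g]] f g unfolding is_coproduct_def by blast
  have def': "copair C f g =
      (THE h. h \<in> hom C (coprod C X Y) Z \<and> h \<cdot> inl C X Y = f \<and> h \<cdot> inr C X Y = g)"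
    by (simp add: copair_def homD[OF f] homD[OF g])
  show "copair C f g \<in> hom C (coprod C X Y) Z"
    and "copair C f g \<cdot> inl C X Y = f" and "copair C f g \<cdot> inr C X Y = g"
    using theI'[OF ex1] unfolding def' by blast+
  show "copair C f g = h"
    if "h \<in> hom C (coprod C X Y) Z" "h \<cdot> inl C X Y = f" "h \<cdot> inr C X Y = g"
    using ex1 that unfolding def' by (blast intro: the1_equality)
qed

lemma cmp_copair:
  assumes f: "f \<in> hom C X Z" and g: "g \<in> hom C Y Z" and h: "h \<in> hom C Z V"
  shows "h \<cdot> copair C f g = copair C (h \<cdot> f) (h \<cdot> g)"
proof (rule copair_eqI[symmetric, OF cmp_in_hom[OF f h] cmp_in_hom[OF g h]])
  note inj = inl_in_hom[OF homD(4)[OF f] homD(4)[OF g]] inr_in_hom[OF homD(4)[OF f] homD(4)[OF g]]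
  note fg = copair_in_hom[OF f g]
  show "h \<cdot> copair C f g \<in> hom C (coprod C X Y) V"
    by (rule cmp_in_hom[OF fg h])
  show "(h \<cdot> copair C f g) \<cdot> inl C X Y = h \<cdot> f"
    by (simp add: cmp_assoc[OF inj(1) fg h] copair_inl[OF f g])
  show "(h \<cdot> copair C f g) \<cdot> inr C X Y = h \<cdot> g"
    by (simp add: cmp_assoc[OF inj(2) fg h] copair_inr[OF f g])
qed

end

section \<open>Typing of the two factors of an arrow\<close>

context factorisation_system
begin

text \<open>The axiom \<open>factorisation\<close> fixes only the middle object. That the factors
  are arrows at all comes from being epi and mono, and their outer ends are forced by the composite
  being \<open>f\<close>.\<close>

lemma
  assumes "f \<in> hom C X Y"
  shows fac_e_in_hom: "fac_e C f \<in> hom C X (dm C (fac_m C f))"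
    and fac_m_in_hom: "fac_m C f \<in> hom C (dm C (fac_m C f)) Y"
proof -
  have fac: "fac_e C f \<in> EE C" "fac_m C f \<in> MM C" "cd C (fac_e C f) = dm C (fac_m C f)"
    "fac_m C f \<cdot> fac_e C f = f"
    using factorisation homD(1)[OF assms] by blast+
  have ar: "fac_e C f \<in> Ar C" "fac_m C f \<in> Ar C"
    using EE_epi[OF fac(1)] MM_mono[OF fac(2)] by (auto simp: is_epi_def is_mono_def)
  have e: "fac_e C f \<in> hom C (dm C (fac_e C f)) (dm C (fac_m C f))"
    and m: "fac_m C f \<in> hom C (dm C (fac_m C f)) (cd C (fac_m C f))"
    using ar fac(3) by (simp_all add: hom_def)
  \<comment> \<open>An arrow has one domain and one codomain, so typing \<open>f\<close> by its
    factors identifies their outer ends with \<open>X\<close> and \<open>Y\<close>.\<close>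
  have "f \<in> hom C (dm C (fac_e C f)) (cd C (fac_m C f))"
    using cmp_in_hom[OF e m] fac(4) by simp
  then show "fac_e C f \<in> hom C X (dm C (fac_m C f))"
    and "fac_m C f \<in> hom C (dm C (fac_m C f)) Y"
    using e m homD(2,3)[OF assms] by (auto simp: hom_def)
qed

end

section \<open>Homomorphisms of automata, the functor F_I, and runs along recursive
  coalgebras\<close>

definition automaton_hom ::
  "('o, 'a, 'm) aut_category_scheme \<Rightarrow> ('o, 'a) automaton \<Rightarrow> ('o, 'a) automaton \<Rightarrow> 'a \<Rightarrow> bool" where
  "automaton_hom C A B h \<longleftrightarrow> h \<in> hom C (states A) (states B) \<and>
     h \<cdot>\<^bsub>C\<^esub> init A = init B \<and>
     h \<cdot>\<^bsub>C\<^esub> delta A = delta B \<cdot>\<^bsub>C\<^esub> Fa C h \<and>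
     out B \<cdot>\<^bsub>C\<^esub> h = out A"

context automata_setting
begin

text \<open>The second fact, [i, d] . F_I f = [i, d . F f], eliminates F_I from recursion equations:
  afterwards only copairs and F itself have to be handled.\<close>

lemma
  assumes f: "f \<in> hom C X Y"
  shows FIa_in_hom: "FIa C f \<in> hom C (FIo C X) (FIo C Y)"
    and copair_cmp_FIa: "\<lbrakk>i \<in> hom C (Iob C) Z; d \<in> hom C (Fo C Y) Z\<rbrakk>
          \<Longrightarrow> copair C i d \<cdot> FIa C f = copair C i (d \<cdot> Fa C f)"
proof -
  let ?I = "Iob C"
  have Ff: "Fa C f \<in> hom C (Fo C X) (Fo C Y)" and I: "?I \<in> Ob C"
    by (simp_all add: Fa_in_hom[OF f] Iob_in_Ob)
  note ob = homD(5)[OF Ff] homD(4)[OF Ff]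
  let ?l = "inl C ?I (Fo C Y)" and ?r = "inr C ?I (Fo C Y) \<cdot> Fa C f"
  have l: "?l \<in> hom C ?I (FIo C Y)" and inr: "inr C ?I (Fo C Y) \<in> hom C (Fo C Y) (FIo C Y)"
    using inl_in_hom[OF I ob(1)] inr_in_hom[OF I ob(1)] by (simp_all add: FIo_def)
  note r = cmp_in_hom[OF Ff inr]
  \<comment> \<open>The left component is the injection composed with the identity on
    \<open>Iob C\<close>, which collapses to the injection.\<close>
  have FIa: "FIa C f = copair C ?l ?r"
    using homD[OF Ff] homD[OF ident_in_hom[OF I]] cmp_ident_right[OF l]
    by (simp add: FIa_def coprod_ar_def)
  show "FIa C f \<in> hom C (FIo C X) (FIo C Y)"
    using copair_in_hom[OF l r] by (simp add: FIa FIo_def)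
  assume i: "i \<in> hom C ?I Z" and d: "d \<in> hom C (Fo C Y) Z"
  have id: "copair C i d \<in> hom C (FIo C Y) Z"
    using copair_in_hom[OF i d] by (simp add: FIo_def)
  show "copair C i d \<cdot> FIa C f = copair C i (d \<cdot> Fa C f)"
    by (simp add: FIa cmp_copair[OF l r id] copair_inl[OF i d] copair_inr[OF i d]
        cmp_assoc[OF Ff inr id, symmetric])
qed

text \<open>Recursiveness specialised to algebras [i, d] coming from automata, with the recursion
  equation in the form h = [i, d . F h] . \<rho>.\<close>

lemma
  assumes rec: "recursive C S \<rho>" and i: "i \<in> hom C (Iob C) X" and d: "d \<in> hom C (Fo C X) X"
  shows rec_ext_in_hom: "rec_ext C \<rho> (copair C i d) \<in> hom C S X"
    and rec_ext_fixed_point: "rec_ext C \<rho> (copair C i d) =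
          copair C i (d \<cdot> Fa C (rec_ext C \<rho> (copair C i d))) \<cdot> \<rho>"
    and rec_ext_eqI: "\<lbrakk>h \<in> hom C S X; h = copair C i (d \<cdot> Fa C h) \<cdot> \<rho>\<rbrakk>
          \<Longrightarrow> rec_ext C \<rho> (copair C i d) = h"
proof -
  let ?x = "copair C i d"
  have x: "?x \<in> hom C (FIo C X) X"
    using copair_in_hom[OF i d] by (simp add: FIo_def)
  have \<rho>: "\<rho> \<in> hom C S (FIo C S)"
    using rec by (simp add: recursive_def)
  have ex1: "\<exists>!h. h \<in> hom C S X \<and> h = ?x \<cdot> FIa C h \<cdot> \<rho>"
    using rec x homD(5)[OF x] unfolding recursive_def by blast
  have def': "rec_ext C \<rho> ?x = (THE h. h \<in> hom C S X \<and> h = ?x \<cdot> FIa C h \<cdot> \<rho>)"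
    by (simp add: rec_ext_def homD[OF \<rho>] homD[OF x])
  have step: "?x \<cdot> FIa C h \<cdot> \<rho> = copair C i (d \<cdot> Fa C h) \<cdot> \<rho>" if h: "h \<in> hom C S X" for h
    using cmp_assoc[OF \<rho> FIa_in_hom[OF h] x] copair_cmp_FIa[OF h i d] by simp
  have rec_ext: "rec_ext C \<rho> ?x \<in> hom C S X"
      "rec_ext C \<rho> ?x = ?x \<cdot> FIa C (rec_ext C \<rho> ?x) \<cdot> \<rho>"
    using theI'[OF ex1] unfolding def' by blast+
  show "rec_ext C \<rho> ?x \<in> hom C S X"
    by (rule rec_ext(1))
  show "rec_ext C \<rho> ?x = copair C i (d \<cdot> Fa C (rec_ext C \<rho> ?x)) \<cdot> \<rho>"
    using rec_ext(2) unfolding step[OF rec_ext(1)] .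
  show "rec_ext C \<rho> ?x = h" if "h \<in> hom C S X" "h = copair C i (d \<cdot> Fa C h) \<cdot> \<rho>"
    using ex1 that step[OF that(1)] unfolding def' by (intro the1_equality) simp_all
qed

text \<open>If r is the run of \<open>A\<close>, then h . r solves the recursion equation of
  \<open>B\<close>, so by uniqueness it is the run of \<open>B\<close>; preservation of outputs then
  identifies the languages.\<close>

lemma rlang_automaton_hom:
  assumes rec: "recursive C S \<rho>" and A: "is_automaton C A" and B: "is_automaton C B"
    and h: "automaton_hom C A B h"
  shows "rlang C \<rho> A = rlang C \<rho> B"
proof -
  have \<rho>: "\<rho> \<in> hom C S (coprod C (Iob C) (Fo C S))"
    using rec by (simp add: recursive_def FIo_def)
  have i: "init A \<in> hom C (Iob C) (states A)" and d: "delta A \<in> hom C (Fo C (states A)) (states A)"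
    using A by (auto simp: is_automaton_def)
  have i': "init B \<in> hom C (Iob C) (states B)" and d': "delta B \<in> hom C (Fo C (states B)) (states B)"
    and o': "out B \<in> hom C (states B) (Oob C)"
    using B by (auto simp: is_automaton_def)
  have h_hom: "h \<in> hom C (states A) (states B)" and h_init: "h \<cdot> init A = init B"
    and h_delta: "h \<cdot> delta A = delta B \<cdot> Fa C h" and h_out: "out B \<cdot> h = out A"
    using h by (auto simp: automaton_hom_def)
  define r where "r = rec_ext C \<rho> (copair C (init A) (delta A))"
  have r: "r \<in> hom C S (states A)" and r_eq: "r = copair C (init A) (delta A \<cdot> Fa C r) \<cdot> \<rho>"
    unfolding r_def using rec_ext_in_hom[OF rec i d] rec_ext_fixed_point[OF rec i d] by auto
  note Fr = Fa_in_hom[OF r] and Fh = Fa_in_hom[OF h_hom]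
  note dFr = cmp_in_hom[OF Fr d]
  \<comment> \<open>The homomorphism law for transitions moves h past \<open>delta A\<close>, and
    functoriality merges F h with F r.\<close>
  have "h \<cdot> delta A \<cdot> Fa C r = delta B \<cdot> Fa C (h \<cdot> r)"
    by (simp add: cmp_assoc[OF Fr d h_hom, symmetric] h_delta cmp_assoc[OF Fr Fh d']
        Fa_cmp[OF r h_hom])
  then have "h \<cdot> copair C (init A) (delta A \<cdot> Fa C r) = copair C (init B) (delta B \<cdot> Fa C (h \<cdot> r))"
    by (simp add: cmp_copair[OF i dFr h_hom] h_init)
  then have "h \<cdot> r = copair C (init B) (delta B \<cdot> Fa C (h \<cdot> r)) \<cdot> \<rho>"
    using r_eq cmp_assoc[OF \<rho> copair_in_hom[OF i dFr] h_hom] by metis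
  then have "rec_ext C \<rho> (copair C (init B) (delta B)) = h \<cdot> r"
    by (rule rec_ext_eqI[OF rec i' d' cmp_in_hom[OF r h_hom]])
  then show ?thesis
    using cmp_assoc[OF r h_hom o'] h_out by (simp add: rlang_def r_def)
qed

section \<open>Wrappers and their hypothesis automata\<close>

lemma wrapper_homs:
  assumes W: "is_wrapper C Q W"
  shows "wr_in W \<in> hom C (dm C (wr_in W)) Q"
    and "wr_out W \<in> hom C Q (cd C (wr_out W))"
    and "wr_e C W \<in> hom C (dm C (wr_in W)) (wr_H C W)"
    and "wr_m C W \<in> hom C (wr_H C W) (cd C (wr_out W))"
    and "wr_m C W \<cdot> wr_e C W = wr_out W \<cdot> wr_in W"
    and "wr_e C W \<in> EE C" and "wr_m C W \<in> MM C"
proof -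
  show a: "wr_in W \<in> hom C (dm C (wr_in W)) Q"
    and b: "wr_out W \<in> hom C Q (cd C (wr_out W))"
    using W by (auto simp: is_wrapper_def hom_def)
  note ba = cmp_in_hom[OF a b]
  show "wr_e C W \<in> hom C (dm C (wr_in W)) (wr_H C W)"
    and "wr_m C W \<in> hom C (wr_H C W) (cd C (wr_out W))"
    using fac_e_in_hom[OF ba] fac_m_in_hom[OF ba] by (simp_all add: wr_e_def wr_m_def wr_H_def)
  show "wr_m C W \<cdot> wr_e C W = wr_out W \<cdot> wr_in W" "wr_e C W \<in> EE C" "wr_m C W \<in> MM C"
    using factorisation[OF homD(1)[OF ba]] by (simp_all add: wr_e_def wr_m_def)
qed

text \<open>This replaces the definite descriptions by equations. The initial and closing witnesses
  are unique because m is mono, the output and consistency witnesses because e and F e are epi, and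
  the transition is the diagonal between F e and m.\<close>

lemma
  assumes A: "is_automaton C A" and W: "is_wrapper C (states A) W"
    and cl: "closed C A W" and co: "consistent C A W"
  shows is_automaton_hypothesis: "is_automaton C (hypothesis C A W)"
    and wr_m_init: "wr_m C W \<cdot> init (hypothesis C A W) = wr_out W \<cdot> init A"
    and wr_m_delta_Fa_wr_e:
      "wr_m C W \<cdot> delta (hypothesis C A W) \<cdot> Fa C (wr_e C W) = wr_out W \<cdot> delta A \<cdot> Fa C (wr_in W)"
    and out_wr_e: "out (hypothesis C A W) \<cdot> wr_e C W = out A \<cdot> wr_in W"
proof -
  let ?H = "wr_H C W" and ?e = "wr_e C W" and ?m = "wr_m C W"
  note w = wrapper_homs[OF W]
  note Fe = Fa_in_hom[OF w(3)]
  \<comment> \<open>Preservation of E by F serves twice: F e is epi, and it may be the left-hand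
    arrow of a diagonal square.\<close>
  have FeE: "Fa C ?e \<in> EE C"
    by (rule F_preserves_EE[OF w(6)])
  note mono = mono_cancel[OF MM_mono[OF w(7)] w(4)]
  note epi = epi_cancel[OF EE_epi[OF w(6)] w(3)] and epiF = epi_cancel[OF EE_epi[OF FeE] Fe]
  have "\<exists>!i. is_init_wit C A W i"
    using cl mono unfolding closed_def is_init_wit_def by metis
  then have i: "is_init_wit C A W (wr_init C A W)"
    unfolding wr_init_def by (rule theI')
  have "\<exists>!c. is_close_wit C A W c"
    using cl mono unfolding closed_def is_close_wit_def by metis
  then have c: "is_close_wit C A W (wr_close C A W)"
    unfolding wr_close_def by (rule theI')
  have "\<exists>!p. is_out_wit C A W p"
    using co epi unfolding consistent_def is_out_wit_def by metis
  then have p: "is_out_wit C A W (wr_outp C A W)"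
    unfolding wr_outp_def by (rule theI')
  have "\<exists>!k. is_cons_wit C A W k"
    using co epiF unfolding consistent_def is_cons_wit_def by metis
  then have k: "is_cons_wit C A W (wr_cons C A W)"
    unfolding wr_cons_def by (rule theI')
  \<comment> \<open>The square commutes because m after \<open>wr_close\<close> and
    \<open>wr_cons\<close> after F e both equal \<beta> . \<delta> . F \<alpha>.\<close>
  have "\<exists>!d. d \<in> hom C (cd C (Fa C ?e)) (dm C ?m) \<and>
      d \<cdot> Fa C ?e = wr_close C A W \<and> ?m \<cdot> d = wr_cons C A W"
    using c k by (intro diagonal[OF FeE w(7)])
      (simp_all add: is_close_wit_def is_cons_wit_def homD(2,3)[OF Fe] homD(2,3)[OF w(4)])
  then have "\<exists>!d. d \<in> hom C (Fo C ?H) ?H \<and>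
      d \<cdot> Fa C ?e = wr_close C A W \<and> ?m \<cdot> d = wr_cons C A W"
    by (simp add: homD(3)[OF Fe] homD(2)[OF w(4)])
  then have d: "wr_delta C A W \<in> hom C (Fo C ?H) ?H \<and>
      wr_delta C A W \<cdot> Fa C ?e = wr_close C A W \<and> ?m \<cdot> wr_delta C A W = wr_cons C A W"
    unfolding wr_delta_def by (rule theI')
  show "is_automaton C (hypothesis C A W)"
    using homD(4)[OF w(4)] i p d
    by (simp add: is_automaton_def hypothesis_def is_init_wit_def is_out_wit_def)
  show "?m \<cdot> init (hypothesis C A W) = wr_out W \<cdot> init A"
    using i by (simp add: hypothesis_def is_init_wit_def)
  show "?m \<cdot> delta (hypothesis C A W) \<cdot> Fa C ?e = wr_out W \<cdot> delta A \<cdot> Fa C (wr_in W)"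
    using c d by (simp add: hypothesis_def is_close_wit_def)
  show "out (hypothesis C A W) \<cdot> ?e = out A \<cdot> wr_in W"
    using p by (simp add: hypothesis_def is_out_wit_def)
qed

text \<open>The transition of the hypothesis is known along F e; precomposing with F s and using
  functoriality extends this to any arrow that factors through e. It will be applied with s a
  coproduct injection.\<close>

lemma hypothesis_delta_Fa_factor:
  assumes A: "is_automaton C A" and W: "is_wrapper C (states A) W"
    and cl: "closed C A W" and co: "consistent C A W"
    and s: "s \<in> hom C S (dm C (wr_in W))"
  shows "wr_m C W \<cdot> delta (hypothesis C A W) \<cdot> Fa C (wr_e C W \<cdot> s) =
    wr_out W \<cdot> delta A \<cdot> Fa C (wr_in W \<cdot> s)"
proof -
  let ?dH = "delta (hypothesis C A W)"
  note w = wrapper_homs[OF W]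
  note Fs = Fa_in_hom[OF s] and Fe = Fa_in_hom[OF w(3)] and Fa = Fa_in_hom[OF w(1)]
  have dH: "?dH \<in> hom C (Fo C (wr_H C W)) (wr_H C W)"
    using is_automaton_hypothesis[OF A W cl co] by (simp add: is_automaton_def hypothesis_def)
  have d: "delta A \<in> hom C (Fo C (states A)) (states A)"
    using A by (simp add: is_automaton_def)
  have "wr_m C W \<cdot> ?dH \<cdot> Fa C (wr_e C W \<cdot> s) = (wr_m C W \<cdot> ?dH \<cdot> Fa C (wr_e C W)) \<cdot> Fa C s"
    by (simp add: Fa_cmp[OF s w(3)] cmp_assoc[OF Fs cmp_in_hom[OF Fe dH] w(4)]
        cmp_assoc[OF Fs Fe dH])
  also have "\<dots> = (wr_out W \<cdot> delta A \<cdot> Fa C (wr_in W)) \<cdot> Fa C s"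
    by (simp add: wr_m_delta_Fa_wr_e[OF A W cl co])
  also have "\<dots> = wr_out W \<cdot> delta A \<cdot> Fa C (wr_in W \<cdot> s)"
    by (simp add: Fa_cmp[OF s w(1)] cmp_assoc[OF Fs cmp_in_hom[OF Fa d] w(2)]
        cmp_assoc[OF Fs Fa d])
  finally show ?thesis .
qed

text \<open>When the target's run passes through the input arrow of the wrapper via s, the run of
  the hypothesis is e . s. Outputs agree since the hypothesis output after e is the target output
  after the input arrow.\<close>

lemma rlang_hypothesis_if_rec_ext_factors:
  assumes A: "is_automaton C A" and W: "is_wrapper C (states A) W"
    and cl: "closed C A W" and co: "consistent C A W"
    and rec: "recursive C S \<rho>"
    and s: "s \<in> hom C S (dm C (wr_in W))"
    and fac: "wr_in W \<cdot> s = rec_ext C \<rho> (copair C (init A) (delta A))"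
  shows "rlang C \<rho> (hypothesis C A W) = rlang C \<rho> A"
proof -
  let ?HA = "hypothesis C A W" and ?m = "wr_m C W" and ?e = "wr_e C W"
  let ?b = "wr_out W" and ?a = "wr_in W"
  note w = wrapper_homs[OF W]
  have \<rho>: "\<rho> \<in> hom C S (coprod C (Iob C) (Fo C S))"
    using rec by (simp add: recursive_def FIo_def)
  have i: "init A \<in> hom C (Iob C) (states A)" and d: "delta A \<in> hom C (Fo C (states A)) (states A)"
    and o: "out A \<in> hom C (states A) (Oob C)"
    using A by (auto simp: is_automaton_def)
  have iH: "init ?HA \<in> hom C (Iob C) (wr_H C W)"
    and dH: "delta ?HA \<in> hom C (Fo C (wr_H C W)) (wr_H C W)"
    and oH: "out ?HA \<in> hom C (wr_H C W) (Oob C)"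
    using is_automaton_hypothesis[OF A W cl co] by (auto simp: is_automaton_def hypothesis_def)
  note as = cmp_in_hom[OF s w(1)] and es = cmp_in_hom[OF s w(3)]
  note dF = cmp_in_hom[OF Fa_in_hom[OF as] d] and dHF = cmp_in_hom[OF Fa_in_hom[OF es] dH]
  \<comment> \<open>Being the run of the target, the composite satisfies the target's recursion
    equation.\<close>
  have as_eq: "?a \<cdot> s = copair C (init A) (delta A \<cdot> Fa C (?a \<cdot> s)) \<cdot> \<rho>"
    using rec_ext_fixed_point[OF rec i d] by (simp add: fac)
  \<comment> \<open>The recursion equation for e . s is checked after m: there m . e turns into the
    wrapper composite, the target's recursion unfolds once, and the equations of the hypothesis turn
    the result back into an arrow followed by m.\<close>
  have "?m \<cdot> ?e \<cdot> s = ?b \<cdot> ?a \<cdot> s"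
    using cmp_assoc[OF s w(3,4)] cmp_assoc[OF s w(1,2)] w(5) by simp
  also have "\<dots> = ?b \<cdot> copair C (init A) (delta A \<cdot> Fa C (?a \<cdot> s)) \<cdot> \<rho>"
    using as_eq by simp
  also have "\<dots> = copair C (?b \<cdot> init A) (?b \<cdot> delta A \<cdot> Fa C (?a \<cdot> s)) \<cdot> \<rho>"
    using cmp_assoc[OF \<rho> copair_in_hom[OF i dF] w(2)] cmp_copair[OF i dF w(2)] by simp
  also have "\<dots> = copair C (?m \<cdot> init ?HA) (?m \<cdot> delta ?HA \<cdot> Fa C (?e \<cdot> s)) \<cdot> \<rho>"
    by (simp add: wr_m_init[OF A W cl co] hypothesis_delta_Fa_factor[OF A W cl co s])
  also have "\<dots> = ?m \<cdot> copair C (init ?HA) (delta ?HA \<cdot> Fa C (?e \<cdot> s)) \<cdot> \<rho>"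
    using cmp_assoc[OF \<rho> copair_in_hom[OF iH dHF] w(4)] cmp_copair[OF iH dHF w(4)] by simp
  finally have "?e \<cdot> s = copair C (init ?HA) (delta ?HA \<cdot> Fa C (?e \<cdot> s)) \<cdot> \<rho>"
    by (rule mono_cancel[OF MM_mono[OF w(7)] w(4) es cmp_in_hom[OF \<rho> copair_in_hom[OF iH dHF]]])
  then have "rec_ext C \<rho> (copair C (init ?HA) (delta ?HA)) = ?e \<cdot> s"
    by (rule rec_ext_eqI[OF rec iH dH es])
  then show ?thesis
    using cmp_assoc[OF s w(3) oH] cmp_assoc[OF s w(1) o] out_wr_e[OF A W cl co]
    by (simp add: rlang_def fac)
qed

text \<open>The homomorphism is the diagonal of the square m' . (e' . s) = m . e. Each law follows
  by cancellation: m' for the initial arrow, m' and then F e for the transition, e for the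
  output.\<close>

lemma automaton_hom_hypotheses:
  assumes A: "is_automaton C A"
    and W: "is_wrapper C (states A) W" and cl: "closed C A W" and co: "consistent C A W"
    and W': "is_wrapper C (states A) W'" and cl': "closed C A W'" and co': "consistent C A W'"
    and s: "s \<in> hom C (dm C (wr_in W)) (dm C (wr_in W'))"
    and fac: "wr_in W = wr_in W' \<cdot> s" and out_eq: "wr_out W = wr_out W'"
  shows "\<exists>h. automaton_hom C (hypothesis C A W) (hypothesis C A W') h"
proof -
  let ?H = "wr_H C W" and ?m = "wr_m C W" and ?e = "wr_e C W" and ?HA = "hypothesis C A W"
  let ?H' = "wr_H C W'" and ?m' = "wr_m C W'" and ?e' = "wr_e C W'" and ?HA' = "hypothesis C A W'"
  note w = wrapper_homs[OF W] and w' = wrapper_homs[OF W']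
  \<comment> \<open>Both wrappers share their output arrow, so m and m' have the same codomain; this
    retyping makes the square well-typed.\<close>
  note m = w(4)[unfolded out_eq]
  have o: "out A \<in> hom C (states A) (Oob C)"
    using A by (auto simp: is_automaton_def)
  have iH: "init ?HA \<in> hom C (Iob C) ?H" and dH: "delta ?HA \<in> hom C (Fo C ?H) ?H"
    and oH: "out ?HA \<in> hom C ?H (Oob C)"
    using is_automaton_hypothesis[OF A W cl co] by (auto simp: is_automaton_def hypothesis_def)
  have iH': "init ?HA' \<in> hom C (Iob C) ?H'" and dH': "delta ?HA' \<in> hom C (Fo C ?H') ?H'"
    and oH': "out ?HA' \<in> hom C ?H' (Oob C)"
    using is_automaton_hypothesis[OF A W' cl' co'] by (auto simp: is_automaton_def hypothesis_def)
  note e's = cmp_in_hom[OF s w'(3)]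
  have "?m' \<cdot> ?e' \<cdot> s = ?m \<cdot> ?e"
    using cmp_assoc[OF s w'(3,4)] cmp_assoc[OF s w'(1,2)] w(5) w'(5) by (simp add: fac out_eq)
  then have "\<exists>!h. h \<in> hom C (cd C ?e) (dm C ?m') \<and> h \<cdot> ?e = ?e' \<cdot> s \<and> ?m' \<cdot> h = ?m"
    using e's m by (intro diagonal[OF w(6) w'(7)])
      (simp_all add: homD(2,3)[OF w(3)] homD(2,3)[OF w'(4)])
  then obtain h where h: "h \<in> hom C ?H ?H'" and he: "h \<cdot> ?e = ?e' \<cdot> s" and mh: "?m' \<cdot> h = ?m"
    using homD(3)[OF w(3)] homD(2)[OF w'(4)] by auto
  note Fe = Fa_in_hom[OF w(3)] and Fh = Fa_in_hom[OF h]
  note mono = mono_cancel[OF MM_mono[OF w'(7)] w'(4)]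
  have "?m' \<cdot> h \<cdot> init ?HA = ?m' \<cdot> init ?HA'"
    using cmp_assoc[OF iH h w'(4)] wr_m_init[OF A W cl co] wr_m_init[OF A W' cl' co']
    by (simp add: mh out_eq)
  then have "h \<cdot> init ?HA = init ?HA'"
    by (rule mono[OF cmp_in_hom[OF iH h] iH'])
  moreover have "h \<cdot> delta ?HA = delta ?HA' \<cdot> Fa C h"
  proof -
    note hd = cmp_in_hom[OF dH h] and dh = cmp_in_hom[OF Fh dH']
    \<comment> \<open>Framed by m' and F e, both sides reduce to \<beta> . \<delta> . F \<alpha> of
      the smaller wrapper, where \<alpha> is its input arrow.\<close>
    have "?m' \<cdot> (h \<cdot> delta ?HA) \<cdot> Fa C ?e = ?m \<cdot> delta ?HA \<cdot> Fa C ?e"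
      using cmp_assoc[OF Fe dH h] cmp_assoc[OF cmp_in_hom[OF Fe dH] h w'(4)] by (simp add: mh)
    also have "\<dots> = ?m' \<cdot> delta ?HA' \<cdot> Fa C (?e' \<cdot> s)"
      using wr_m_delta_Fa_wr_e[OF A W cl co] hypothesis_delta_Fa_factor[OF A W' cl' co' s]
      by (simp add: fac out_eq)
    also have "\<dots> = ?m' \<cdot> (delta ?HA' \<cdot> Fa C h) \<cdot> Fa C ?e"
      using cmp_assoc[OF Fe Fh dH'] Fa_cmp[OF w(3) h] by (simp add: he)
    finally have "(h \<cdot> delta ?HA) \<cdot> Fa C ?e = (delta ?HA' \<cdot> Fa C h) \<cdot> Fa C ?e"
      by (rule mono[OF cmp_in_hom[OF Fe hd] cmp_in_hom[OF Fe dh]])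
    then show ?thesis
      by (rule epi_cancel[OF EE_epi[OF F_preserves_EE[OF w(6)]] Fe hd dh])
  qed
  moreover have "out ?HA' \<cdot> h = out ?HA"
  proof -
    \<comment> \<open>Precomposed with e, both outputs become the target output after
      \<open>wr_in W\<close>.\<close>
    have "(out ?HA' \<cdot> h) \<cdot> ?e = (out ?HA' \<cdot> ?e') \<cdot> s"
      using cmp_assoc[OF w(3) h oH'] cmp_assoc[OF s w'(3) oH'] by (simp add: he)
    also have "\<dots> = out ?HA \<cdot> ?e"
      using cmp_assoc[OF s w'(1) o] out_wr_e[OF A W cl co] out_wr_e[OF A W' cl' co']
      by (simp add: fac)
    finally show ?thesis
      by (rule epi_cancel[OF EE_epi[OF w(6)] w(3) cmp_in_hom[OF h oH'] oH])
  qed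
  ultimately show ?thesis
    using h by (auto simp: automaton_hom_def hypothesis_def)
qed

end

section \<open>Correctness up to \<rho> by passing through the extended wrapper\<close>

theorem theorem18:
  fixes C :: "('o, 'a) aut_category"
    and A :: "('o, 'a) automaton"
    and S' :: 'o
    and \<alpha> \<beta> \<rho> :: 'a
  assumes "automata_setting C"
    and "is_automaton C A"
    and "is_wrapper C (states A) \<lparr>wr_in = \<alpha>, wr_out = \<beta>\<rparr>"
    and "closed C A \<lparr>wr_in = \<alpha>, wr_out = \<beta>\<rparr>"
    and "consistent C A \<lparr>wr_in = \<alpha>, wr_out = \<beta>\<rparr>"
    and "recursive C S' \<rho>"
    and "closed C A
           \<lparr>wr_in = copair C \<alpha> (rec_ext C \<rho> (copair C (init A) (delta A))), wr_out = \<beta>\<rparr>"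
    and "consistent C A
           \<lparr>wr_in = copair C \<alpha> (rec_ext C \<rho> (copair C (init A) (delta A))), wr_out = \<beta>\<rparr>"
  shows "correct_up_to C A \<lparr>wr_in = \<alpha>, wr_out = \<beta>\<rparr> \<rho>"
proof -
  interpret automata_setting C by fact
  let ?r = "rec_ext C \<rho> (copair C (init A) (delta A))"
  let ?W = "\<lparr>wr_in = \<alpha>, wr_out = \<beta>\<rparr>" and ?W' = "\<lparr>wr_in = copair C \<alpha> ?r, wr_out = \<beta>\<rparr>"
  note A = assms(2) and W = assms(3-5) and rec = assms(6)
  have \<alpha>: "\<alpha> \<in> hom C (dm C \<alpha>) (states A)"
    using wrapper_homs(1)[OF W(1)] by simp
  have r: "?r \<in> hom C S' (states A)"
    using A by (intro rec_ext_in_hom[OF rec]) (simp_all add: is_automaton_def)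
  note ar = copair_in_hom[OF \<alpha> r] and ob = homD(4)[OF \<alpha>] homD(4)[OF r]
  have W': "is_wrapper C (states A) ?W'"
    using W(1) homD[OF ar] by (simp add: is_wrapper_def)
  \<comment> \<open>The left injection exhibits \<alpha> as a restriction of the extended input
    arrow.\<close>
  have "\<exists>h. automaton_hom C (hypothesis C A ?W) (hypothesis C A ?W') h"
    using inl_in_hom[OF ob] copair_inl[OF \<alpha> r] homD(2)[OF ar]
    by (intro automaton_hom_hypotheses[OF A W W' assms(7,8), of "inl C (dm C \<alpha>) S'"]) simp_all
  then have "rlang C \<rho> (hypothesis C A ?W) = rlang C \<rho> (hypothesis C A ?W')"
    using rlang_automaton_hom[OF rec] is_automaton_hypothesis[OF A W]
      is_automaton_hypothesis[OF A W' assms(7,8)] by blast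
  \<comment> \<open>The right injection exhibits the target's run as a restriction of the same
    arrow.\<close>
  also have "\<dots> = rlang C \<rho> A"
    using inr_in_hom[OF ob] copair_inr[OF \<alpha> r] homD(2)[OF ar]
    by (intro rlang_hypothesis_if_rec_ext_factors[OF A W' assms(7,8) rec,
          of "inr C (dm C \<alpha>) S'"]) simp_all
  finally show ?thesis
    by (simp add: correct_up_to_def)
qed

end
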